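(* Let $H$ be a complex Hilbert space and let $m\in\mathbb{Z}_{1}$. If $p\in\mathbf{B}(H)_{m-1}[z]$ is a polynomial such that (i) $p(0)=I$, (ii) $p(n)$ is positive and invertible for every $n\in\mathbb{N}$, (iii) $C(p):=\sup\left\{\dfrac{\langle p(n+1)h,h\rangle}{\langle p(n)h,h\rangle}: n\in\mathbb{N},\ h\in H,\ h\neq 0\right\}<\infty$, then there exists an $m$-isometric unilateral weighted shift $S\in\mathbf{B}(\ell^{2}(\mathbb{N},H))$ with positive and invertible weights $(S_{j})_{j\in\mathbb{Z}_{1}}\subset\mathbf{B}(H)$ satisfying $p(n)=\lvert S_{n}\cdots S_{1}\rvert^{2}$ for every $n\in\mathbb{Z}_{1}$. Moreover, $\lVert S\rVert=\sqrt{C(p)}$.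
   Context: $\mathbb{N}$ is the set of non-negative integers and $\mathbb{Z}_{p}=\{n\in\mathbb{Z}: n\ge p\}$. $\mathbf{B}(H)$ is the algebra of bounded linear operators on a complex Hilbert space $H$; invertible means invertible in $\mathbf{B}(H)$; $\lvert T\rvert=(T^{*}T)^{1/2}$. An operator $T\in\mathbf{B}(H)$ is called positive if $\langle Tf,f\rangle>0$ for every $f\in H$, $f\neq 0$. $\ell^{2}(\mathbb{N},H)$ is the Hilbert space of square-summable sequences $(h_{i})_{i\in\mathbb{N}}$ in $H$. For a uniformly bounded sequence $(S_{i})_{i\in\mathbb{Z}_{1}}\subset\mathbf{B}(H)$, the unilateral weighted shift $S$ with weights $(S_{i})_{i\in\mathbb{Z}_{1}}$ is the bounded operator on $\ell^{2}(\mathbb{N},H)$ given by $S(h_{0},h_{1},\ldots)=(0,S_{1}h_{0},S_{2}h_{1},\ldots)$. A bounded operator $T$ is $m$-isometric ($m\in\mathbb{Z}_{1}$) if $\sum_{k=0}^{m}\binom{m}{k}(-1)^{m-k}T^{*k}T^{k}=0$. $\mathbf{B}(H)_{n}[z]$ denotes the space of polynomials $p(z)=\sum_{j=0}^{n}A_{j}z^{j}$ with coefficients $A_{j}\in\mathbf{B}(H)$ (degree at most $n$), evaluated at scalars $z\in\mathbb{C}$. Suprema are taken in $[0,\infty]$. *)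

theory Defs
  imports "HOL-Analysis.Analysis"
begin

section \<open>Complex Hilbert spaces\<close>

class complex_vector = real_vector +
  fixes scaleC :: "complex \<Rightarrow> 'a \<Rightarrow> 'a" (infixr "*\<^sub>C" 75)
  assumes scaleC_add_right: "a *\<^sub>C (x + y) = a *\<^sub>C x + a *\<^sub>C y"
    and scaleC_add_left: "(a + b) *\<^sub>C x = a *\<^sub>C x + b *\<^sub>C x"
    and scaleC_scaleC: "a *\<^sub>C b *\<^sub>C x = (a * b) *\<^sub>C x"
    and scaleR_scaleC: "r *\<^sub>R x = complex_of_real r *\<^sub>C x"

text \<open>The inner product is linear in its first argument. Definiteness follows from
  \<open>cinner_norm\<close>, which also ties the topology to the inner product.\<close>

class complex_inner = complex_vector + real_normed_vector +
  fixes cinner :: "'a \<Rightarrow> 'a \<Rightarrow> complex"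
  assumes cinner_commute: "cinner x y = cnj (cinner y x)"
    and cinner_add_left: "cinner (x + y) z = cinner x z + cinner y z"
    and cinner_scaleC_left: "cinner (a *\<^sub>C x) y = a * cinner x y"
    and cinner_norm: "cinner x x = complex_of_real ((norm x)\<^sup>2)"

class chilbert_space = complex_inner + banach

lemma cinner_add_right: "cinner x (y + z) = cinner x y + cinner (x::'a::complex_inner) z"
  by (metis cinner_add_left cinner_commute complex_cnj_add)

lemma cinner_scaleC_right: "cinner x (a *\<^sub>C y) = cnj a * cinner (x::'a::complex_inner) y"
  by (metis cinner_commute cinner_scaleC_left complex_cnj_mult)

lemma norm_scaleC: "norm (a *\<^sub>C x) = cmod a * norm (x::'a::complex_inner)"
proof -
  have "complex_of_real ((norm (a *\<^sub>C x))\<^sup>2) = (a * cnj a) * complex_of_real ((norm x)\<^sup>2)"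
    unfolding cinner_norm[symmetric] by (simp add: cinner_scaleC_left cinner_scaleC_right)
  also have "\<dots> = complex_of_real ((cmod a * norm x)\<^sup>2)"
    by (simp add: complex_norm_square[symmetric] power_mult_distrib)
  finally have "(norm (a *\<^sub>C x))\<^sup>2 = (cmod a * norm x)\<^sup>2"
    using of_real_eq_iff by blast
  then show ?thesis
    by (simp add: power2_eq_iff_nonneg)
qed

lemma Re_cinner_polar:
  "Re (cinner x y) = ((norm (x + y))\<^sup>2 - (norm x)\<^sup>2 - (norm (y::'a::complex_inner))\<^sup>2) / 2"
proof -
  have "(norm (x + y))\<^sup>2 = Re (cinner (x + y) (x + y))"
    by (simp only: cinner_norm Re_complex_of_real)
  also have "\<dots> = Re (cinner x x) + Re (cinner x y) + Re (cinner y x) + Re (cinner y y)"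
    by (simp add: cinner_add_left cinner_add_right)
  also have "Re (cinner y x) = Re (cinner x y)"
    by (metis cinner_commute complex_cnj(1) complex.sel(1) complex.collapse)
  finally show ?thesis
    by (simp add: cinner_norm)
qed

lemma Im_cinner_polar:
  "Im (cinner x y) = Re (cinner x (\<i> *\<^sub>C (y::'a::complex_inner)))"
  by (simp add: cinner_scaleC_right)


section \<open>Square-summable sequences\<close>

typedef (overloaded) 'a ell2 = "{f :: nat \<Rightarrow> 'a::chilbert_space. summable (\<lambda>i. (norm (f i))\<^sup>2)}"
  morphisms ell2_nth Abs_ell2
  by (rule exI[of _ "\<lambda>_. 0"]) simp

setup_lifting type_definition_ell2

lemma summable_ell2: "summable (\<lambda>i. (norm (ell2_nth x i))\<^sup>2)"
  using ell2_nth[of x] by simp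

lemma ell2_add_bound:
  fixes f g :: "nat \<Rightarrow> 'a::real_normed_vector"
  assumes "summable (\<lambda>i. (norm (f i))\<^sup>2)" "summable (\<lambda>i. (norm (g i))\<^sup>2)"
  shows "(\<Sum>i<n. (norm (f i + g i))\<^sup>2) \<le> (sqrt (\<Sum>i. (norm (f i))\<^sup>2) + sqrt (\<Sum>i. (norm (g i))\<^sup>2))\<^sup>2"
proof -
  have "sqrt (\<Sum>i<n. (norm (f i + g i))\<^sup>2) = L2_set (\<lambda>i. norm (f i + g i)) {..<n}"
    by (simp add: L2_set_def)
  also have "\<dots> \<le> L2_set (\<lambda>i. norm (f i) + norm (g i)) {..<n}"
    by (rule L2_set_mono) (auto simp: norm_triangle_ineq)
  also have "\<dots> \<le> L2_set (\<lambda>i. norm (f i)) {..<n} + L2_set (\<lambda>i. norm (g i)) {..<n}"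
    by (rule L2_set_triangle_ineq)
  also have "\<dots> \<le> sqrt (\<Sum>i. (norm (f i))\<^sup>2) + sqrt (\<Sum>i. (norm (g i))\<^sup>2)"
    unfolding L2_set_def using assms
    by (intro add_mono real_sqrt_le_mono sum_le_suminf) auto
  finally show ?thesis
    by (rule sqrt_le_D)
qed

lemma ell2_add_summable:
  fixes f g :: "nat \<Rightarrow> 'a::real_normed_vector"
  assumes "summable (\<lambda>i. (norm (f i))\<^sup>2)" "summable (\<lambda>i. (norm (g i))\<^sup>2)"
  shows "summable (\<lambda>i. (norm (f i + g i))\<^sup>2)"
proof (rule bounded_imp_summable)
  show "(\<Sum>i\<le>n. (norm (f i + g i))\<^sup>2)
      \<le> (sqrt (\<Sum>i. (norm (f i))\<^sup>2) + sqrt (\<Sum>i. (norm (g i))\<^sup>2))\<^sup>2" for n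
    using ell2_add_bound[OF assms, of "Suc n"] by (simp only: lessThan_Suc_atMost)
qed simp

lemma ell2_scaleC_summable:
  fixes f :: "nat \<Rightarrow> 'a::complex_inner"
  assumes "summable (\<lambda>i. (norm (f i))\<^sup>2)"
  shows "summable (\<lambda>i. (norm (a *\<^sub>C f i))\<^sup>2)"
  using assms by (simp add: norm_scaleC power_mult_distrib summable_mult)

lemma ell2_minus_summable:
  fixes f g :: "nat \<Rightarrow> 'a::real_normed_vector"
  assumes "summable (\<lambda>i. (norm (f i))\<^sup>2)" "summable (\<lambda>i. (norm (g i))\<^sup>2)"
  shows "summable (\<lambda>i. (norm (f i - g i))\<^sup>2)"
  using ell2_add_summable[of f "\<lambda>i. - g i"] assms by simp

lemma ell2_cinner_summable:
  fixes f g :: "nat \<Rightarrow> 'a::complex_inner"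
  assumes f: "summable (\<lambda>i. (norm (f i))\<^sup>2)" and g: "summable (\<lambda>i. (norm (g i))\<^sup>2)"
  shows "summable (\<lambda>i. cinner (f i) (g i))"
  unfolding summable_complex_iff Im_cinner_polar Re_cinner_polar
  using f g ell2_scaleC_summable[OF g, of \<i>]
  by (intro conjI summable_divide summable_diff ell2_add_summable)

instantiation ell2 :: (chilbert_space) complex_inner
begin

lift_definition zero_ell2 :: "'a ell2" is "\<lambda>_. 0" by simp
lift_definition plus_ell2 :: "'a ell2 \<Rightarrow> 'a ell2 \<Rightarrow> 'a ell2" is "\<lambda>f g i. f i + g i"
  by (rule ell2_add_summable)
lift_definition minus_ell2 :: "'a ell2 \<Rightarrow> 'a ell2 \<Rightarrow> 'a ell2" is "\<lambda>f g i. f i - g i"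
  by (rule ell2_minus_summable)
lift_definition uminus_ell2 :: "'a ell2 \<Rightarrow> 'a ell2" is "\<lambda>f i. - f i" by simp
lift_definition scaleR_ell2 :: "real \<Rightarrow> 'a ell2 \<Rightarrow> 'a ell2" is "\<lambda>r f i. r *\<^sub>R f i"
  by (simp add: power_mult_distrib summable_mult)
lift_definition scaleC_ell2 :: "complex \<Rightarrow> 'a ell2 \<Rightarrow> 'a ell2" is "\<lambda>a f i. a *\<^sub>C f i"
  by (rule ell2_scaleC_summable)
lift_definition norm_ell2 :: "'a ell2 \<Rightarrow> real" is "\<lambda>f. sqrt (\<Sum>i. (norm (f i))\<^sup>2)" .
lift_definition cinner_ell2 :: "'a ell2 \<Rightarrow> 'a ell2 \<Rightarrow> complex" is "\<lambda>f g. \<Sum>i. cinner (f i) (g i)" .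

definition dist_ell2 :: "'a ell2 \<Rightarrow> 'a ell2 \<Rightarrow> real" where "dist_ell2 x y = norm (x - y)"
definition sgn_ell2 :: "'a ell2 \<Rightarrow> 'a ell2" where "sgn_ell2 x = inverse (norm x) *\<^sub>R x"
definition uniformity_ell2 :: "('a ell2 \<times> 'a ell2) filter"
  where "uniformity_ell2 = (INF e\<in>{0 <..}. principal {(x, y). dist x y < e})"
definition open_ell2 :: "'a ell2 set \<Rightarrow> bool"
  where "open_ell2 U = (\<forall>x\<in>U. \<forall>\<^sub>F (x', y) in uniformity. x' = x \<longrightarrow> y \<in> U)"

instance
proof
  fix x y z :: "'a ell2" and a b :: complex and r s :: real
  show "x + y + z = x + (y + z)"
    by transfer (simp add: add.assoc)
  show "x + y = y + x"
    by transfer (simp add: add.commute)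
  show "0 + x = x" "- x + x = 0" "x - y = x + - y"
    by (transfer, simp)+
  show "r *\<^sub>R (x + y) = r *\<^sub>R x + r *\<^sub>R y" "(r + s) *\<^sub>R x = r *\<^sub>R x + s *\<^sub>R x"
    "r *\<^sub>R s *\<^sub>R x = (r * s) *\<^sub>R x" "1 *\<^sub>R x = x"
    by (transfer, simp add: scaleR_add_right scaleR_add_left)+
  show "a *\<^sub>C (x + y) = a *\<^sub>C x + a *\<^sub>C y" "(a + b) *\<^sub>C x = a *\<^sub>C x + b *\<^sub>C x"
    "a *\<^sub>C b *\<^sub>C x = (a * b) *\<^sub>C x"
    by (transfer, simp add: scaleC_add_right scaleC_add_left scaleC_scaleC)+
  show "r *\<^sub>R x = complex_of_real r *\<^sub>C x"
    by (transfer, simp add: scaleR_scaleC)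
  show "dist x y = norm (x - y)" "sgn x = inverse (norm x) *\<^sub>R x"
    "uniformity = (INF e\<in>{0 <..}. principal {(x::'a ell2, y). dist x y < e})"
    by (simp_all only: dist_ell2_def sgn_ell2_def uniformity_ell2_def)
  show "open U \<longleftrightarrow> (\<forall>x\<in>U. \<forall>\<^sub>F (x', y) in uniformity. x' = x \<longrightarrow> y \<in> U)" for U :: "'a ell2 set"
    by (simp only: open_ell2_def)
  show "norm x = 0 \<longleftrightarrow> x = 0"
    by transfer (auto simp: suminf_eq_zero_iff)
  show "norm (x + y) \<le> norm x + norm y"
  proof transfer
    fix f g :: "nat \<Rightarrow> 'a"
    assume fg: "summable (\<lambda>i. (norm (f i))\<^sup>2)" "summable (\<lambda>i. (norm (g i))\<^sup>2)"
    have "(\<Sum>i. (norm (f i + g i))\<^sup>2) \<le> (sqrt (\<Sum>i. (norm (f i))\<^sup>2) + sqrt (\<Sum>i. (norm (g i))\<^sup>2))\<^sup>2"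
      by (rule suminf_le_const[OF ell2_add_summable[OF fg] ell2_add_bound[OF fg]])
    then show "sqrt (\<Sum>i. (norm (f i + g i))\<^sup>2) \<le> sqrt (\<Sum>i. (norm (f i))\<^sup>2) + sqrt (\<Sum>i. (norm (g i))\<^sup>2)"
      by (rule real_le_lsqrt[rotated]) (simp add: fg suminf_nonneg)
  qed
  show "norm (r *\<^sub>R x) = \<bar>r\<bar> * norm x"
    by transfer (simp add: power_mult_distrib suminf_mult real_sqrt_mult)
  show "cinner x y = cnj (cinner y x)"
  proof transfer
    fix f g :: "nat \<Rightarrow> 'a"
    assume "summable (\<lambda>i. (norm (f i))\<^sup>2)" "summable (\<lambda>i. (norm (g i))\<^sup>2)"
    then have "(\<lambda>i. cnj (cinner (g i) (f i))) sums cnj (\<Sum>i. cinner (g i) (f i))"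
      by (simp only: sums_cnj) (intro summable_sums ell2_cinner_summable)
    then show "(\<Sum>i. cinner (f i) (g i)) = cnj (\<Sum>i. cinner (g i) (f i))"
      by (simp only: cinner_commute[of "g _" "f _"] complex_cnj_cnj sums_iff)
  qed
  show "cinner (x + y) z = cinner x z + cinner y z"
    by transfer (simp add: cinner_add_left suminf_add ell2_cinner_summable)
  show "cinner (a *\<^sub>C x) y = a * cinner x y"
    by transfer (simp add: cinner_scaleC_left suminf_mult ell2_cinner_summable)
  show "cinner x x = complex_of_real ((norm x)\<^sup>2)"
    by transfer (simp add: cinner_norm suminf_of_real suminf_nonneg flip: of_real_power)
qed

end

lemma norm_ell2_nth_le: "norm (ell2_nth x i) \<le> norm x"
proof -
  have "(norm (ell2_nth x i))\<^sup>2 \<le> (\<Sum>i. (norm (ell2_nth x i))\<^sup>2)"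
    using sum_le_suminf[OF summable_ell2, of "{i}" x] by simp
  then show ?thesis
    unfolding norm_ell2.rep_eq by (rule real_le_rsqrt)
qed

lemma sum_norm_ell2_le: "(\<Sum>i<k. (norm (ell2_nth x i))\<^sup>2) \<le> (norm x)\<^sup>2"
proof -
  have "(\<Sum>i<k. (norm (ell2_nth x i))\<^sup>2) \<le> (\<Sum>i. (norm (ell2_nth x i))\<^sup>2)"
    by (rule sum_le_suminf[OF summable_ell2]) auto
  then show ?thesis
    by (simp add: norm_ell2.rep_eq suminf_nonneg[OF summable_ell2])
qed

instance ell2 :: (chilbert_space) chilbert_space
proof
  fix X :: "nat \<Rightarrow> 'a ell2"
  assume X: "Cauchy X"
  define l where "l i = lim (\<lambda>n. ell2_nth (X n) i)" for i
  have "Cauchy (\<lambda>n. ell2_nth (X n) i)" for i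
  proof (rule CauchyI)
    fix e :: real assume "e > 0"
    then obtain M where "\<forall>m\<ge>M. \<forall>n\<ge>M. norm (X m - X n) < e"
      using CauchyD[OF X \<open>e > 0\<close>] by blast
    then show "\<exists>M. \<forall>m\<ge>M. \<forall>n\<ge>M. norm (ell2_nth (X m) i - ell2_nth (X n) i) < e"
      by (metis norm_ell2_nth_le minus_ell2.rep_eq order_le_less_trans)
  qed
  then have l: "(\<lambda>n. ell2_nth (X n) i) \<longlonglongrightarrow> l i" for i
    unfolding l_def using Cauchy_convergent convergent_LIMSEQ_iff by blast
  have tail: "\<exists>M. \<forall>n\<ge>M. \<forall>k. (\<Sum>i<k. (norm (ell2_nth (X n) i - l i))\<^sup>2) \<le> e\<^sup>2" if \<open>e > 0\<close> for e :: real
  proof -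
    obtain M where M: "\<forall>m\<ge>M. \<forall>n\<ge>M. norm (X m - X n) < e"
      using CauchyD[OF X \<open>e > 0\<close>] by blast
    have "(\<Sum>i<k. (norm (ell2_nth (X n) i - l i))\<^sup>2) \<le> e\<^sup>2" if n: "n \<ge> M" for n k
    proof (rule LIMSEQ_le_const2)
      show "(\<lambda>m. \<Sum>i<k. (norm (ell2_nth (X n) i - ell2_nth (X m) i))\<^sup>2)
          \<longlonglongrightarrow> (\<Sum>i<k. (norm (ell2_nth (X n) i - l i))\<^sup>2)"
        by (intro tendsto_intros l)
      have "(\<Sum>i<k. (norm (ell2_nth (X n) i - ell2_nth (X m) i))\<^sup>2) \<le> e\<^sup>2" if "m \<ge> M" for m
      proof -
        have "(\<Sum>i<k. (norm (ell2_nth (X n) i - ell2_nth (X m) i))\<^sup>2) \<le> (norm (X n - X m))\<^sup>2"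
          using sum_norm_ell2_le[of "X n - X m" k] by (simp add: minus_ell2.rep_eq)
        also have "\<dots> \<le> e\<^sup>2"
          using M n that by (intro power_mono) (auto simp: less_imp_le)
        finally show ?thesis .
      qed
      then show "\<exists>N. \<forall>m\<ge>N. (\<Sum>i<k. (norm (ell2_nth (X n) i - ell2_nth (X m) i))\<^sup>2) \<le> e\<^sup>2"
        by blast
    qed
    then show ?thesis by blast
  qed
  have diff: "summable (\<lambda>i. (norm (ell2_nth (X n) i - l i))\<^sup>2)"
    if "\<forall>k. (\<Sum>i<k. (norm (ell2_nth (X n) i - l i))\<^sup>2) \<le> e\<^sup>2" for n e
    by (rule bounded_imp_summable[where B = "e\<^sup>2"]) (use that in \<open>simp_all only: zero_le_power2 flip: lessThan_Suc_atMost\<close>)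
  obtain M where "\<forall>k. (\<Sum>i<k. (norm (ell2_nth (X M) i - l i))\<^sup>2) \<le> 1\<^sup>2"
    using tail[of 1] by auto
  from ell2_minus_summable[OF summable_ell2[of "X M"] diff[OF this]]
  have "summable (\<lambda>i. (norm (l i))\<^sup>2)" by simp
  then have L: "ell2_nth (Abs_ell2 l) = l"
    by (simp add: Abs_ell2_inverse)
  have "X \<longlonglongrightarrow> Abs_ell2 l"
  proof (rule LIMSEQ_I)
    fix e :: real assume "e > 0"
    then obtain M where M: "\<forall>n\<ge>M. \<forall>k. (\<Sum>i<k. (norm (ell2_nth (X n) i - l i))\<^sup>2) \<le> (e/2)\<^sup>2"
      using tail[of "e/2"] by auto
    have "norm (X n - Abs_ell2 l) < e" if "n \<ge> M" for n
    proof -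
      have "(\<Sum>i. (norm (ell2_nth (X n) i - l i))\<^sup>2) \<le> (e/2)\<^sup>2"
        using M that by (intro suminf_le_const diff) auto
      then have "norm (X n - Abs_ell2 l) \<le> e/2"
        unfolding norm_ell2.rep_eq minus_ell2.rep_eq L using \<open>e > 0\<close>
        by (intro real_le_lsqrt) auto
      then show ?thesis using \<open>e > 0\<close> by simp
    qed
    then show "\<exists>M. \<forall>n\<ge>M. norm (X n - Abs_ell2 l) < e" by blast
  qed
  then show "convergent X" by (rule convergentI)
qed


section \<open>Bounded operators\<close>

definition bounded_clinear :: "('a::complex_inner \<Rightarrow> 'b::complex_inner) \<Rightarrow> bool" where
  "bounded_clinear T \<longleftrightarrow> bounded_linear T \<and> (\<forall>a x. T (a *\<^sub>C x) = a *\<^sub>C T x)"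

definition invertible_op :: "('a::chilbert_space \<Rightarrow> 'a) \<Rightarrow> bool" where
  "invertible_op T \<longleftrightarrow>
     bounded_clinear T \<and> (\<exists>R. bounded_clinear R \<and> T \<circ> R = id \<and> R \<circ> T = id)"

text \<open>Strict positivity on nonzero vectors. For the square root below, the usual semidefinite
  notion is needed.\<close>

definition positive_op :: "('a::chilbert_space \<Rightarrow> 'a) \<Rightarrow> bool" where
  "positive_op T \<longleftrightarrow> bounded_clinear T \<and>
     (\<forall>f. f \<noteq> 0 \<longrightarrow> cinner (T f) f \<in> \<real> \<and> 0 < Re (cinner (T f) f))"

definition nonneg_op :: "('a::chilbert_space \<Rightarrow> 'a) \<Rightarrow> bool" where
  "nonneg_op T \<longleftrightarrow> bounded_clinear T \<and>
     (\<forall>f. cinner (T f) f \<in> \<real> \<and> 0 \<le> Re (cinner (T f) f))"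

text \<open>As for \<open>adjoint\<close> in the library, the choice is unique: for every bounded operator exactly
  one function satisfies the defining identity.\<close>

definition cadjoint :: "('a::chilbert_space \<Rightarrow> 'b::chilbert_space) \<Rightarrow> 'b \<Rightarrow> 'a" where
  "cadjoint T = (SOME R. \<forall>x y. cinner (T x) y = cinner x (R y))"

text \<open>A nonnegative bounded operator has exactly one nonnegative square root, so the choice
  is unique here, too.\<close>

definition sqrt_op :: "('a::chilbert_space \<Rightarrow> 'a) \<Rightarrow> 'a \<Rightarrow> 'a" where
  "sqrt_op A = (SOME B. nonneg_op B \<and> B \<circ> B = A)"

definition abs_op :: "('a::chilbert_space \<Rightarrow> 'a) \<Rightarrow> 'a \<Rightarrow> 'a" where
  "abs_op T = sqrt_op (cadjoint T \<circ> T)"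

definition m_isometric :: "nat \<Rightarrow> ('a::chilbert_space \<Rightarrow> 'a) \<Rightarrow> bool" where
  "m_isometric m T \<longleftrightarrow> bounded_clinear T \<and>
     (\<forall>x. (\<Sum>k=0..m. (real (m choose k) * (-1) ^ (m - k)) *\<^sub>R ((cadjoint T ^^ k) ((T ^^ k) x))) = 0)"


section \<open>Operator polynomials and weighted shifts\<close>

text \<open>Polynomials with operator coefficients are represented by their evaluation maps on
  \<open>\<complex>\<close>, which determine the coefficients.\<close>

definition op_polys :: "nat \<Rightarrow> (complex \<Rightarrow> 'a::chilbert_space \<Rightarrow> 'a) set" where
  "op_polys n = {p. \<exists>A. (\<forall>j\<le>n. bounded_clinear (A j)) \<and> (\<forall>z h. p z h = (\<Sum>j=0..n. z ^ j *\<^sub>C A j h))}"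

definition growth_const :: "(complex \<Rightarrow> 'a::chilbert_space \<Rightarrow> 'a) \<Rightarrow> ennreal" where
  "growth_const p = Sup {ennreal (Re (cinner (p (of_nat (n + 1)) h) h / cinner (p (of_nat n) h) h)) | n h. h \<noteq> 0}"

text \<open>Weights are indexed from \<open>1\<close>; the value \<open>W 0\<close> is never used.\<close>

definition unilateral_weighted_shift ::
    "(nat \<Rightarrow> 'a::chilbert_space \<Rightarrow> 'a) \<Rightarrow> ('a ell2 \<Rightarrow> 'a ell2) \<Rightarrow> bool" where
  "unilateral_weighted_shift W S \<longleftrightarrow>
     (\<forall>i\<ge>1. bounded_clinear (W i)) \<and> (\<exists>M. \<forall>i\<ge>1. onorm (W i) \<le> M) \<and>
     bounded_clinear S \<and>
     (\<forall>h. ell2_nth (S h) 0 = 0 \<and> (\<forall>i. ell2_nth (S h) (Suc i) = W (Suc i) (ell2_nth h i)))"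

text \<open>\<open>weight_prod W n\<close> is \<open>W n \<circ> \<dots> \<circ> W 1\<close>.\<close>

primrec weight_prod :: "(nat \<Rightarrow> 'a \<Rightarrow> 'a) \<Rightarrow> nat \<Rightarrow> 'a \<Rightarrow> 'a" where
  "weight_prod W 0 = id"
| "weight_prod W (Suc n) = W (Suc n) \<circ> weight_prod W n"

end

theory Submission
  imports Defs
begin

text \<open>Write \<open>P\<^sub>n = W\<^sub>n \<cdots> W\<^sub>1\<close> and let \<open>R\<^sub>n\<close> be its adjoint. Given \<open>R\<^sub>n P\<^sub>n = p(n)\<close> with
  \<open>P\<^sub>n\<close> invertible, the operator \<open>R\<^sub>n\<^sup>-\<^sup>1 p(n + 1) P\<^sub>n\<^sup>-\<^sup>1\<close> is positive and invertible, and taking its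
  positive square root as \<open>W\<^sub>n\<^sub>+\<^sub>1\<close> gives \<open>R\<^sub>n\<^sub>+\<^sub>1 P\<^sub>n\<^sub>+\<^sub>1 = p(n + 1)\<close>. The quotients defining \<open>C(p)\<close> are
  \<open>\<parallel>W\<^sub>n\<^sub>+\<^sub>1 x\<parallel>\<^sup>2 / \<parallel>x\<parallel>\<^sup>2\<close> with \<open>x = P\<^sub>n h\<close> arbitrary, which yields the norm of the shift. If \<open>h\<^sub>i = P\<^sub>i g\<close>,
  then \<open>R\<^sub>i\<close> maps the \<open>i\<close>-th entry of \<open>S\<^sup>*\<^sup>k S\<^sup>k h\<close> to \<open>p(i + k) g\<close>, so the \<open>m\<close>-isometry identity says that the
  \<open>m\<close>-th differences of a polynomial of degree less than \<open>m\<close> vanish. All adjoints are explicit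
  because the weights are self-adjoint.\<close>

section \<open>Inner products and self-adjointness\<close>

lemma cinner_zero_left [simp]: "cinner 0 (y::'a::complex_inner) = 0"
  using cinner_add_left[of 0 0 y] by simp

lemma cinner_zero_right [simp]: "cinner (y::'a::complex_inner) 0 = 0"
  using cinner_add_right[of y 0 0] by simp

lemma cinner_minus_left: "cinner (- x) (y::'a::complex_inner) = - cinner x y"
  using cinner_add_left[of "- x" x y] by (simp add: eq_neg_iff_add_eq_0)

lemma cinner_minus_right: "cinner x (- y::'a::complex_inner) = - cinner x y"
  using cinner_add_right[of x "- y" y] by (simp add: eq_neg_iff_add_eq_0)

lemma cinner_diff_left: "cinner (x - y) (z::'a::complex_inner) = cinner x z - cinner y z"
  using cinner_add_left[of x "- y" z] by (simp add: cinner_minus_left)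

lemma cinner_diff_right: "cinner x (y - z::'a::complex_inner) = cinner x y - cinner x z"
  using cinner_add_right[of x y "- z"] by (simp add: cinner_minus_right)

lemma cinner_scaleR_left: "cinner (r *\<^sub>R x) (y::'a::complex_inner) = of_real r * cinner x y"
  by (simp add: scaleR_scaleC cinner_scaleC_left)

lemma cinner_scaleR_right: "cinner x (r *\<^sub>R y::'a::complex_inner) = of_real r * cinner x y"
  by (simp add: scaleR_scaleC cinner_scaleC_right)

lemmas cinner_algebra = cinner_add_left cinner_add_right cinner_diff_left cinner_diff_right
  cinner_scaleR_left cinner_scaleR_right

text \<open>Cauchy-Schwarz for the real part is the squared triangle inequality, read through
  polarisation.\<close>

lemma Re_cinner_le: "Re (cinner x y) \<le> norm x * norm (y::'a::complex_inner)"
proof -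
  have "(norm (x + y))\<^sup>2 \<le> (norm x + norm y)\<^sup>2"
    by (intro power_mono norm_triangle_ineq) simp
  then show ?thesis
    by (simp add: Re_cinner_polar power2_sum)
qed

lemma cinner_left_eqI:
  assumes "\<And>y. cinner x y = cinner z (y::'a::complex_inner)"
  shows "x = z"
proof -
  have "cinner (x - z) (x - z) = 0"
    using assms by (simp only: cinner_diff_left) simp
  then show ?thesis by (simp add: cinner_norm)
qed

lemma cinner_right_eqI:
  assumes "\<And>x. cinner x y = cinner x (z::'a::complex_inner)"
  shows "y = z"
  using assms by (intro cinner_left_eqI) (metis cinner_commute)

lemma bounded_linear_scaleC_right: "bounded_linear (\<lambda>x::'a::complex_inner. a *\<^sub>C x)"
proof (rule bounded_linear_intro[where K = "cmod a"])
  show "a *\<^sub>C r *\<^sub>R x = r *\<^sub>R a *\<^sub>C x" for r and x :: 'a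
    by (simp add: scaleR_scaleC scaleC_scaleC mult.commute)
qed (simp_all add: scaleC_add_right norm_scaleC mult.commute)

text \<open>Polarisation writes the inner product through norms, which are continuous. This makes
  the set of self-adjoint operators closed in the fixed point argument for square roots.\<close>

lemma continuous_on_cinner:
  fixes f g :: "'b::topological_space \<Rightarrow> 'a::complex_inner"
  assumes "continuous_on S f" "continuous_on S g"
  shows "continuous_on S (\<lambda>x. cinner (f x) (g x))"
proof -
  have eq: "cinner u v = complex_of_real (((norm (u + v))\<^sup>2 - (norm u)\<^sup>2 - (norm v)\<^sup>2) / 2)
      + \<i> * complex_of_real (((norm (u + \<i> *\<^sub>C v))\<^sup>2 - (norm u)\<^sup>2 - (norm (\<i> *\<^sub>C v))\<^sup>2) / 2)" for u v :: 'a
    by (simp only: Re_cinner_polar[symmetric] Im_cinner_polar[symmetric]) (rule complex_eq)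
  show ?thesis
    by (subst eq) (intro continuous_intros assms bounded_linear.continuous_on[OF bounded_linear_scaleC_right]; simp)
qed

definition selfadj :: "('a::complex_inner \<Rightarrow> 'a) \<Rightarrow> bool" where
  "selfadj T \<longleftrightarrow> (\<forall>x y. cinner (T x) y = cinner x (T y))"

text \<open>The type \<open>blinfun\<close> only records real linearity. Complex homogeneity of
  operators obtained there is recovered from self-adjointness.\<close>

lemma selfadj_scaleC:
  assumes "selfadj T"
  shows "T (a *\<^sub>C x) = a *\<^sub>C T x"
  using assms by (intro cinner_left_eqI) (simp add: selfadj_def cinner_scaleC_left)

lemma selfadj_real:
  assumes "selfadj T"
  shows "cinner (T x) x \<in> \<real>"
  by (metis assms selfadj_def cinner_commute Reals_cnj_iff)

lemma selfadjI_real: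
  fixes T :: "'a::complex_inner \<Rightarrow> 'a"
  assumes T: "bounded_clinear T" and real: "\<And>x. cinner (T x) x \<in> \<real>"
  shows "selfadj T"
  unfolding selfadj_def
proof (intro allI)
  fix x y
  have add: "T (u + v) = T u + T v" and sc: "T (a *\<^sub>C u) = a *\<^sub>C T u" for u v a
    using T by (simp_all add: bounded_clinear_def linear_add bounded_linear.linear)
  have im: "Im (cinner (T u) u) = 0" for u
    using real[of u] by (simp add: complex_is_Real_iff)
  have "Im (cinner (T x) y) = - Im (cinner (T y) x)"
    using im[of "x + y"] im[of x] im[of y] by (simp add: add cinner_add_left cinner_add_right)
  moreover have "Re (cinner (T x) y) = Re (cinner (T y) x)"
    using im[of "x + \<i> *\<^sub>C y"] im[of x] im[of y]
    by (simp add: add sc cinner_add_left cinner_add_right cinner_scaleC_left cinner_scaleC_right)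
  ultimately show "cinner (T x) y = cinner x (T y)"
    by (subst (2) cinner_commute) (simp add: complex_eq_iff)
qed

text \<open>A witness makes the choice in \<open>cadjoint\<close> satisfy the defining identity, and
  nondegeneracy of the inner product makes it unique.\<close>

lemma cadjoint_eqI:
  assumes "\<And>x y. cinner (T x) y = cinner x (R y)"
  shows "cadjoint T = R"
proof -
  have "\<forall>x y. cinner (T x) y = cinner x (cadjoint T y)"
    unfolding cadjoint_def by (rule someI[of _ R]) (simp add: assms)
  then show ?thesis
    using assms by (intro ext cinner_right_eqI) metis
qed

section \<open>Composition and inverses of bounded operators\<close>

lemma bounded_clinear_compose:
  "bounded_clinear S \<Longrightarrow> bounded_clinear T \<Longrightarrow> bounded_clinear (S \<circ> T)"
  by (simp add: bounded_clinear_def bounded_linear_compose comp_def)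

lemma invertible_op_compose:
  assumes "invertible_op S" "invertible_op T"
  shows "invertible_op (S \<circ> T)"
proof -
  obtain S' T' where "bounded_clinear S'" "S \<circ> S' = id" "S' \<circ> S = id"
      "bounded_clinear T'" "T \<circ> T' = id" "T' \<circ> T = id"
    using assms unfolding invertible_op_def by blast
  then have "bounded_clinear (T' \<circ> S')" "(S \<circ> T) \<circ> (T' \<circ> S') = id" "(T' \<circ> S') \<circ> (S \<circ> T) = id"
    by (auto simp: bounded_clinear_compose fun_eq_iff)
  then show ?thesis
    using assms unfolding invertible_op_def by (metis bounded_clinear_compose)
qed

lemma invertible_op_inverse:
  assumes "bounded_clinear S" "bounded_clinear T" "S \<circ> T = id" "T \<circ> S = id"
  shows "invertible_op S"
  using assms unfolding invertible_op_def by blast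

section \<open>Square roots of positive invertible operators\<close>

lemma positive_op_selfadj: "positive_op A \<Longrightarrow> selfadj A"
  unfolding positive_op_def by (rule selfadjI_real) (auto, metis cinner_zero_right Reals_0)

lemma positive_op_nonneg_op: "positive_op A \<Longrightarrow> nonneg_op A"
  unfolding positive_op_def nonneg_op_def
  by (metis cinner_zero_right Reals_0 less_imp_le order_refl zero_complex.sel(1))

text \<open>This is \<open>A\<^sup>2 \<le> K A\<close> as forms. Nonnegativity is tested on
  \<open>x - (1 / K) *\<^sub>R A x\<close>; the cubic term is at most
  \<open>K * (norm (A x))\<^sup>2\<close> and cancels half of the quadratic term.\<close>

lemma nonneg_op_norm_sq_le:
  fixes A :: "'a::chilbert_space \<Rightarrow> 'a"
  assumes A: "nonneg_op A" and K: "K > 0" "\<And>x. norm (A x) \<le> K * norm x"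
  shows "(norm (A x))\<^sup>2 \<le> K * Re (cinner (A x) x)"
proof -
  have "bounded_clinear A" and nonneg: "0 \<le> Re (cinner (A y) y)" for y
    using A by (simp_all add: nonneg_op_def)
  have "selfadj A"
    using A by (auto simp: nonneg_op_def intro: selfadjI_real)
  then have sa: "cinner (A (A x)) x = cinner (A x) (A x)"
    by (simp add: selfadj_def)
  have lin: "A (x - (1 / K) *\<^sub>R A x) = A x - (1 / K) *\<^sub>R A (A x)"
    using \<open>bounded_clinear A\<close> by (simp add: bounded_clinear_def linear_diff bounded_linear.linear linear_scale)
  have "0 \<le> Re (cinner (A (x - (1 / K) *\<^sub>R A x)) (x - (1 / K) *\<^sub>R A x))"
    by (rule nonneg)
  also have "\<dots> = Re (cinner (A x) x) - 2 / K * (norm (A x))\<^sup>2 + Re (cinner (A (A x)) (A x)) / K\<^sup>2"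
    unfolding lin using K(1)
    by (simp add: cinner_algebra sa cinner_norm power2_eq_square) (simp add: field_simps)
  also have "Re (cinner (A (A x)) (A x)) \<le> K * norm (A x) * norm (A x)"
    by (rule order_trans[OF Re_cinner_le]) (intro mult_right_mono K, simp)
  finally have "0 \<le> Re (cinner (A x) x) - 2 / K * (norm (A x))\<^sup>2 + K * norm (A x) * norm (A x) / K\<^sup>2"
    using K(1) by (simp add: divide_right_mono)
  then show ?thesis
    using K(1) by (simp add: field_simps power2_eq_square)
qed

text \<open>Banach's fixed point theorem for \<open>Y \<mapsto> (X + Y\<^sup>2) / 2\<close> on the self-adjoint part of the ball of
  radius \<open>\<parallel>X\<parallel> < 1\<close>: a fixed point satisfies \<open>(1 - Y)\<^sup>2 = 1 - X\<close>.\<close>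

lemma near_identity_sqrt:
  fixes X :: "'a::chilbert_space \<Rightarrow>\<^sub>L 'a"
  assumes X: "norm X < 1" "selfadj (blinfun_apply X)"
  shows "\<exists>Y. norm Y \<le> norm X \<and> selfadj (blinfun_apply Y)
    \<and> (id_blinfun - Y) o\<^sub>L (id_blinfun - Y) = id_blinfun - X"
proof -
  define r where "r = norm X"
  have r: "0 \<le> r" "r < 1" using X by (simp_all add: r_def)
  define F where "F Y = (1 / 2) *\<^sub>R (X + (Y o\<^sub>L Y))" for Y :: "'a \<Rightarrow>\<^sub>L 'a"
  define D where "D = cball 0 r \<inter> {Y :: 'a \<Rightarrow>\<^sub>L 'a. \<forall>x y. cinner (blinfun_apply Y x) y = cinner x (blinfun_apply Y y)}"
  have "closed D"
    unfolding D_def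
    by (intro closed_Int closed_Collect_all closed_Collect_eq continuous_on_cinner closed_cball continuous_intros)
  then have "complete D" by (simp add: complete_eq_closed)
  moreover have "D \<noteq> {}" using r by (auto simp: D_def ex_in_conv[symmetric] intro!: exI[of _ 0])
  moreover have "F ` D \<subseteq> D"
  proof (intro image_subsetI)
    fix Y assume "Y \<in> D"
    then have Y: "norm Y \<le> r" "\<And>x y. cinner (blinfun_apply Y x) y = cinner x (blinfun_apply Y y)"
      by (auto simp: D_def)
    \<comment> \<open>The bound \<open>r * r \<le> r\<close> uses \<open>r < 1\<close>; averaging
      with \<open>norm X = r\<close> keeps \<open>F Y\<close> in the ball.\<close>
    have "norm (Y o\<^sub>L Y) \<le> r * 1"
      by (rule order_trans[OF norm_blinfun_compose]) (use Y r in \<open>intro mult_mono; simp\<close>)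
    then have "norm (F Y) \<le> r"
      using norm_triangle_ineq[of X "Y o\<^sub>L Y"] by (simp add: F_def r_def)
    moreover have "cinner (blinfun_apply (F Y) x) y = cinner x (blinfun_apply (F Y) y)" for x y
      using X(2) Y(2) by (simp add: F_def blinfun.bilinear_simps cinner_algebra selfadj_def)
    ultimately show "F Y \<in> D" by (simp add: D_def)
  qed
  moreover have "dist (F Y) (F Z) \<le> r * dist Y Z" if "Y \<in> D" "Z \<in> D" for Y Z
  proof -
    have "norm Y \<le> r" "norm Z \<le> r" using that by (auto simp: D_def)
    \<comment> \<open>As \<open>Y\<close> and \<open>Z\<close> need not commute, the difference of
      squares is split asymmetrically. Each summand costs a factor \<open>r\<close>, and the
      \<open>1 / 2\<close> in \<open>F\<close> leaves the contraction constant
      \<open>r\<close>.\<close>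
    have "F Y - F Z = (1 / 2) *\<^sub>R ((Y o\<^sub>L (Y - Z)) + ((Y - Z) o\<^sub>L Z))"
      by (rule blinfun_eqI) (simp add: F_def blinfun.bilinear_simps algebra_simps)
    then have "norm (F Y - F Z) \<le> (norm (Y o\<^sub>L (Y - Z)) + norm ((Y - Z) o\<^sub>L Z)) / 2"
      using norm_triangle_ineq[of "Y o\<^sub>L (Y - Z)" "(Y - Z) o\<^sub>L Z"] by simp
    also have "\<dots> \<le> (norm Y * norm (Y - Z) + norm (Y - Z) * norm Z) / 2"
      by (intro divide_right_mono add_mono norm_blinfun_compose) simp
    also have "\<dots> \<le> (r * norm (Y - Z) + norm (Y - Z) * r) / 2"
      using \<open>norm Y \<le> r\<close> \<open>norm Z \<le> r\<close>
      by (intro divide_right_mono add_mono mult_right_mono mult_left_mono) auto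
    finally show ?thesis by (simp add: dist_norm mult.commute)
  qed
  ultimately obtain Y where Y: "Y \<in> D" "F Y = Y"
    using Banach_fix[of D r F] r by blast
  have "blinfun_apply Y x + blinfun_apply Y x = blinfun_apply X x + blinfun_apply Y (blinfun_apply Y x)" for x
  proof -
    have "blinfun_apply Y x = (1 / 2) *\<^sub>R (blinfun_apply X x + blinfun_apply Y (blinfun_apply Y x))"
      by (subst (1) Y(2)[symmetric]) (simp add: F_def blinfun.bilinear_simps)
    moreover have "u + u = w" if "u = (1 / 2) *\<^sub>R w" for u w :: 'a
      using that by (simp flip: scaleR_2)
    ultimately show ?thesis by blast
  qed
  then have "(id_blinfun - Y) o\<^sub>L (id_blinfun - Y) = id_blinfun - X"
    by (intro blinfun_eqI) (simp add: blinfun.bilinear_simps algebra_simps)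
  then show ?thesis
    using Y(1) by (auto simp: D_def r_def selfadj_def)
qed

text \<open>Since \<open>A\<close> is bounded above and below, \<open>X = 1 - A / K\<close> has norm
  below 1. A root \<open>1 - Y\<close> of \<open>1 - X\<close> then gives the root
  \<open>sqrt K\<close> times \<open>1 - Y\<close> of \<open>A\<close>, strictly positive because
  \<open>norm Y < 1\<close>.\<close>

lemma positive_invertible_sqrt:
  fixes A :: "'a::chilbert_space \<Rightarrow> 'a"
  assumes pos: "positive_op A" and inv: "invertible_op A"
  obtains B where "positive_op B" "invertible_op B" "B \<circ> B = A"
proof -
  obtain R where R: "bounded_clinear R" "A \<circ> R = id" "R \<circ> A = id"
    using inv unfolding invertible_op_def by blast
  have A: "bounded_clinear A" "bounded_linear A"
    using pos by (simp_all add: positive_op_def bounded_clinear_def)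
  obtain K where K: "K > 0" "\<And>x. norm (A x) \<le> K * norm x"
    using bounded_linear.pos_bounded[OF A(2)] by (metis mult.commute)
  obtain L where L: "L > 0" "\<And>x. norm (R x) \<le> L * norm x"
    using bounded_linear.pos_bounded[of R] R(1) by (metis mult.commute bounded_clinear_def)
  \<comment> \<open>The inverse bound gives
    \<open>(norm (A x))\<^sup>2 / K\<^sup>2 \<ge> q * (norm x)\<^sup>2\<close>, the amount by which
    \<open>X\<close> shrinks squared norms.\<close>
  define q where "q = 1 / (K\<^sup>2 * L\<^sup>2)"
  have "q > 0" using K L by (simp add: q_def)
  \<comment> \<open>On the zero space \<open>K\<close> and \<open>L\<close> are unrelated and
    \<open>q\<close> may exceed 1; the maximum keeps the radicand nonnegative.\<close>
  define r where "r = sqrt (max 0 (1 - q))"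
  have r: "0 \<le> r" "r < 1" using \<open>q > 0\<close> by (simp_all add: r_def)
  define X where "X = id_blinfun - (1 / K) *\<^sub>R Blinfun A"
  have X_apply: "blinfun_apply X x = x - (1 / K) *\<^sub>R A x" for x
    by (simp add: X_def blinfun.bilinear_simps bounded_linear_Blinfun_apply[OF A(2)])
  have "norm (blinfun_apply X x) \<le> r * norm x" for x
  proof (rule power2_le_imp_le)
    have 1: "(norm (A x))\<^sup>2 \<le> K * Re (cinner (A x) x)"
      by (rule nonneg_op_norm_sq_le[OF positive_op_nonneg_op[OF pos] K])
    have "norm x \<le> L * norm (A x)"
      using L(2)[of "A x"] R(3) by (simp add: fun_eq_iff)
    then have 2: "(norm x)\<^sup>2 \<le> L\<^sup>2 * (norm (A x))\<^sup>2"
      by (metis norm_ge_zero power_mono power_mult_distrib)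
    have sym: "Re (cinner x (A x)) = Re (cinner (A x) x)"
      by (subst cinner_commute) simp
    have "(norm (blinfun_apply X x))\<^sup>2 = Re (cinner (blinfun_apply X x) (blinfun_apply X x))"
      by (simp add: cinner_norm flip: of_real_power)
    also have "\<dots> = (norm x)\<^sup>2 - 2 / K * Re (cinner (A x) x) + (norm (A x))\<^sup>2 / K\<^sup>2"
      unfolding X_apply cinner_algebra
      by (simp add: sym cinner_norm power2_eq_square flip: of_real_mult) (simp add: field_simps diff_divide_distrib)
    also have "\<dots> \<le> (norm x)\<^sup>2 - (norm (A x))\<^sup>2 / K\<^sup>2"
    proof -
      have "(norm (A x))\<^sup>2 / K\<^sup>2 \<le> Re (cinner (A x) x) / K"
        using 1 K(1) by (simp add: field_simps power2_eq_square)
      then show ?thesis by simp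
    qed
    also have "\<dots> \<le> (norm x)\<^sup>2 - q * (norm x)\<^sup>2"
      using 2 K(1) L(1) by (simp add: q_def field_simps)
    also have "\<dots> = (1 - q) * (norm x)\<^sup>2"
      by (simp add: algebra_simps)
    also have "\<dots> \<le> r\<^sup>2 * (norm x)\<^sup>2"
      unfolding r_def by (intro mult_right_mono) auto
    finally show "(norm (blinfun_apply X x))\<^sup>2 \<le> (r * norm x)\<^sup>2"
      by (simp add: power_mult_distrib)
  qed (simp add: r)
  then have "norm X \<le> r" by (intro norm_blinfun_bound r)
  then have "norm X < 1" using r by simp
  moreover have "selfadj (blinfun_apply X)"
    using positive_op_selfadj[OF pos] by (simp add: selfadj_def X_apply cinner_algebra)
  ultimately obtain Y where Y: "norm Y \<le> norm X" "selfadj (blinfun_apply Y)"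
    "(id_blinfun - Y) o\<^sub>L (id_blinfun - Y) = id_blinfun - X"
    using near_identity_sqrt by blast
  define B where "B x = sqrt K *\<^sub>R (x - blinfun_apply Y x)" for x
  have "bounded_linear B"
    unfolding B_def by (intro bounded_linear_intros blinfun.bounded_linear_right)
  moreover have saB: "selfadj B"
    using Y(2) by (simp add: selfadj_def B_def cinner_algebra)
  ultimately have B: "bounded_clinear B"
    by (simp add: bounded_clinear_def selfadj_scaleC)
  have BB: "B \<circ> B = A"
  proof
    fix x
    have "B (B x) = K *\<^sub>R blinfun_apply ((id_blinfun - Y) o\<^sub>L (id_blinfun - Y)) x"
      using K(1) by (simp add: B_def blinfun.bilinear_simps flip: scaleR_right_diff_distrib)
    also have "\<dots> = A x"
      unfolding Y(3) using K(1) by (simp add: blinfun.bilinear_simps X_apply)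
    finally show "(B \<circ> B) x = A x" by simp
  qed
  have "positive_op B"
    unfolding positive_op_def
  proof (intro conjI allI impI B selfadj_real[OF saB])
    fix x :: 'a assume "x \<noteq> 0"
    have "Re (cinner (blinfun_apply Y x) x) \<le> norm Y * norm x * norm x"
      by (rule order_trans[OF Re_cinner_le]) (intro mult_right_mono norm_blinfun, simp)
    also have "\<dots> < 1 * norm x * norm x"
      using \<open>x \<noteq> 0\<close> Y(1) \<open>norm X < 1\<close> by (intro mult_strict_right_mono) auto
    finally show "0 < Re (cinner (B x) x)"
      using K(1) by (simp add: B_def cinner_algebra cinner_norm power2_eq_square)
  qed
  moreover have "invertible_op B"
  proof (rule invertible_op_inverse)
    show "bounded_clinear (B \<circ> R)" by (intro bounded_clinear_compose B R)
    have *: "B (B x) = A x" "A (R x) = x" "R (A x) = x" for x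
      using BB R by (simp_all add: fun_eq_iff)
    \<comment> \<open>\<open>B\<close> commutes with its square \<open>A\<close>, hence with the
      inverse \<open>R\<close> of \<open>A\<close>; so \<open>B \<circ> R\<close> is a two-sided
      inverse of \<open>B\<close>.\<close>
    then have "B (R x) = R (B x)" for x
      by (metis *)
    with * show "B \<circ> (B \<circ> R) = id" "(B \<circ> R) \<circ> B = id"
      by (auto simp: fun_eq_iff)
  qed (rule B)
  ultimately show thesis using BB that by blast
qed

section \<open>Finite differences\<close>

text \<open>Pascal's rule splits the coefficients; the half with \<open>m choose Suc k\<close>,
  completed by the term at 0, is minus the sum of order \<open>m\<close> for \<open>f\<close>
  itself. Iterated, this identifies the alternating sum with a higher forward difference.\<close>

lemma alternating_binomial_sum_Suc:
  fixes f :: "nat \<Rightarrow> 'a::comm_ring_1"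
  shows "(\<Sum>k\<le>Suc m. of_nat (Suc m choose k) * (-1) ^ (Suc m - k) * f k)
    = (\<Sum>k\<le>m. of_nat (m choose k) * (-1) ^ (m - k) * (f (Suc k) - f k))"
proof -
  have "(\<Sum>k\<le>Suc m. of_nat (Suc m choose k) * (-1) ^ (Suc m - k) * f k)
     = (-1) ^ Suc m * f 0 + (\<Sum>k\<le>m. of_nat (m choose k) * (-1) ^ (m - k) * f (Suc k))
       + (\<Sum>k\<le>m. of_nat (m choose Suc k) * (-1) ^ (m - k) * f (Suc k))"
    by (subst sum.atMost_Suc_shift) (simp add: algebra_simps sum.distrib)
  also have "(-1) ^ Suc m * f 0 + (\<Sum>k\<le>m. of_nat (m choose k) * (-1) ^ (m - k) * f (Suc k))
       + (\<Sum>k\<le>m. of_nat (m choose Suc k) * (-1) ^ (m - k) * f (Suc k))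
     = (\<Sum>k\<le>m. of_nat (m choose k) * (-1) ^ (m - k) * f (Suc k))
       + (\<Sum>k\<le>Suc m. of_nat (m choose k) * (-1) ^ (Suc m - k) * f k)"
    by (simp add: sum.atMost_Suc_shift[of "\<lambda>k. of_nat (m choose k) * (-1) ^ (Suc m - k) * f k"]
        del: sum.atMost_Suc)
  \<comment> \<open>The top summand vanishes because \<open>m choose Suc m = 0\<close>; in the
    others, lowering the exponent costs a sign.\<close>
  also have "(\<Sum>k\<le>Suc m. of_nat (m choose k) * (-1) ^ (Suc m - k) * f k)
     = (\<Sum>k\<le>m. - (of_nat (m choose k) * (-1) ^ (m - k) * f k))"
    by (simp add: Suc_diff_le binomial_eq_0)
  finally show ?thesis
    by (simp add: algebra_simps sum.distrib sum_negf sum_subtractf)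
qed

text \<open>Induction on \<open>m\<close>: the forward difference of a \<open>j\<close>-th power is
  a combination of powers with exponents below \<open>j\<close>. The offset \<open>x\<close> later
  becomes the position of an entry in the sequence.\<close>

lemma alternating_binomial_sum_power_eq_0:
  fixes x :: "'a::comm_ring_1"
  assumes "j < m"
  shows "(\<Sum>k\<le>m. of_nat (m choose k) * (-1) ^ (m - k) * (x + of_nat k) ^ j) = 0"
  using assms
proof (induction m arbitrary: j)
  case (Suc m)
  have "(x + of_nat (Suc k)) ^ j - (x + of_nat k) ^ j = (\<Sum>l<j. of_nat (j choose l) * (x + of_nat k) ^ l)" for k
  proof -
    have "((x + of_nat k) + 1) ^ j = (\<Sum>l\<le>j. of_nat (j choose l) * (x + of_nat k) ^ l)"
      by (subst binomial_ring) simp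
    then show ?thesis
      by (simp add: algebra_simps flip: lessThan_Suc_atMost)
  qed
  then have "(\<Sum>k\<le>Suc m. of_nat (Suc m choose k) * (-1) ^ (Suc m - k) * (x + of_nat k) ^ j)
     = (\<Sum>k\<le>m. \<Sum>l<j. of_nat (j choose l) * (of_nat (m choose k) * (-1) ^ (m - k) * (x + of_nat k) ^ l))"
    by (simp only: alternating_binomial_sum_Suc sum_distrib_left) (simp add: mult_ac)
  also have "\<dots> = (\<Sum>l<j. of_nat (j choose l) * (\<Sum>k\<le>m. of_nat (m choose k) * (-1) ^ (m - k) * (x + of_nat k) ^ l))"
    by (subst sum.swap) (simp only: sum_distrib_left)
  also have "\<dots> = 0"
    using Suc by (intro sum.neutral) auto
  finally show ?case .
qed simp

section \<open>Differences of operator polynomials\<close>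

lemma scaleC_zero_left [simp]: "0 *\<^sub>C (x::'a::complex_inner) = 0"
  using norm_scaleC[of 0 x] by simp

lemma scaleC_sum_left: "sum f I *\<^sub>C (x::'a::complex_inner) = (\<Sum>i\<in>I. f i *\<^sub>C x)"
  by (induction I rule: infinite_finite_induct) (simp_all add: scaleC_add_left)

lemma op_polys_difference_eq_0:
  fixes p :: "complex \<Rightarrow> 'a::chilbert_space \<Rightarrow> 'a"
  assumes p: "p \<in> op_polys (m - 1)" and m: "m \<ge> 1"
  shows "(\<Sum>k=0..m. (real (m choose k) * (-1) ^ (m - k)) *\<^sub>R p (of_nat (i + k)) h) = 0"
proof -
  obtain A where A: "p z h = (\<Sum>j=0..m - 1. z ^ j *\<^sub>C A j h)" for z h
    using p unfolding op_polys_def by blast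
  let ?c = "\<lambda>k. of_nat (m choose k) * (-1) ^ (m - k) :: complex"
  have "(\<Sum>k=0..m. (real (m choose k) * (-1) ^ (m - k)) *\<^sub>R p (of_nat (i + k)) h)
     = (\<Sum>k=0..m. \<Sum>j=0..m - 1. (?c k * of_nat (i + k) ^ j) *\<^sub>C A j h)"
    unfolding A
    by (simp add: scaleR_scaleC linear_sum[OF bounded_linear.linear[OF bounded_linear_scaleC_right]] scaleC_scaleC)
  also have "\<dots> = (\<Sum>j=0..m - 1. (\<Sum>k\<le>m. ?c k * (of_nat i + of_nat k) ^ j) *\<^sub>C A j h)"
    by (subst sum.swap) (simp add: scaleC_sum_left atLeast0AtMost)
  also have "\<dots> = 0"
    \<comment> \<open>With \<open>m \<ge> 1\<close> the range \<open>j \<le> m - 1\<close> means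
      \<open>j < m\<close>; truncated subtraction would break this at \<open>m = 0\<close>.\<close>
    using m by (intro sum.neutral ballI) (subst alternating_binomial_sum_power_eq_0, auto)
  finally show ?thesis .
qed

section \<open>Weighted shifts\<close>

definition wshift :: "(nat \<Rightarrow> 'a \<Rightarrow> 'a) \<Rightarrow> 'a::chilbert_space ell2 \<Rightarrow> 'a ell2" where
  "wshift W h = Abs_ell2 (\<lambda>i. case i of 0 \<Rightarrow> 0 | Suc j \<Rightarrow> W (Suc j) (ell2_nth h j))"

text \<open>The backward shift carries the weights themselves instead of their adjoints, which is
  correct for self-adjoint weights.\<close>

definition wshift_adj :: "(nat \<Rightarrow> 'a \<Rightarrow> 'a) \<Rightarrow> 'a::chilbert_space ell2 \<Rightarrow> 'a ell2" where
  "wshift_adj W h = Abs_ell2 (\<lambda>i. W (Suc i) (ell2_nth h (Suc i)))"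

definition single_ell2 :: "nat \<Rightarrow> 'a::chilbert_space \<Rightarrow> 'a ell2" where
  "single_ell2 n x = Abs_ell2 (\<lambda>i. if i = n then x else 0)"

lemma ell2_eqI: "(\<And>i. ell2_nth x i = ell2_nth y i) \<Longrightarrow> x = y"
  by (metis ell2_nth_inject ext)

lemma power2_norm_ell2: "(norm x)\<^sup>2 = (\<Sum>i. (norm (ell2_nth x i))\<^sup>2)"
  by (simp add: norm_ell2.rep_eq suminf_nonneg summable_ell2)

lemma ell2_nth_single: "ell2_nth (single_ell2 n x) i = (if i = n then x else 0)"
proof -
  have "summable (\<lambda>i. (norm (if i = n then x else 0))\<^sup>2)"
    by (rule summable_finite[of "{n}"]) auto
  then show ?thesis
    unfolding single_ell2_def by (simp add: Abs_ell2_inverse)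
qed

lemma norm_single_ell2: "norm (single_ell2 n x) = norm x"
proof -
  have "(norm (single_ell2 n x))\<^sup>2 = (norm x)\<^sup>2"
    unfolding power2_norm_ell2 ell2_nth_single
    by (subst suminf_finite[of "{n}"]) auto
  then show ?thesis by simp
qed

lemma ell2_nth_sum: "ell2_nth (sum f I) i = (\<Sum>j\<in>I. ell2_nth (f j) i)"
  by (induction I rule: infinite_finite_induct) (simp_all add: zero_ell2.rep_eq plus_ell2.rep_eq)

text \<open>The uniform bound makes the sequences given to \<open>Abs_ell2\<close> square-summable.
  It is later instantiated with \<open>sqrt C\<close>, so that it also yields the upper estimate of
  the norm of the shift.\<close>

locale bounded_selfadj_weights =
  fixes W :: "nat \<Rightarrow> 'a::chilbert_space \<Rightarrow> 'a" and M :: real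
  assumes bounded: "\<And>i. bounded_clinear (W (Suc i))"
    and sa: "\<And>i. selfadj (W (Suc i))"
    and M: "M \<ge> 0" "\<And>i x. norm (W (Suc i) x) \<le> M * norm x"
begin

lemma norm_sq_weight_le: "(norm (W (Suc i) x))\<^sup>2 \<le> M\<^sup>2 * (norm x)\<^sup>2"
  using power_mono[OF M(2), of i x 2] by (simp add: power_mult_distrib)

lemma summable_shift: "summable (\<lambda>i. (norm (W (Suc i) (ell2_nth h i)))\<^sup>2)"
  by (rule summable_comparison_test'[OF summable_mult[OF summable_ell2[of h], of "M\<^sup>2"]])
    (simp add: norm_sq_weight_le)

lemma ell2_nth_wshift:
  "ell2_nth (wshift W h) 0 = 0" "ell2_nth (wshift W h) (Suc i) = W (Suc i) (ell2_nth h i)"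
proof -
  have "summable (\<lambda>i. (norm (case i of 0 \<Rightarrow> 0 | Suc j \<Rightarrow> W (Suc j) (ell2_nth h j)))\<^sup>2)"
    by (subst summable_Suc_iff[symmetric]) (simp add: summable_shift)
  then have "ell2_nth (wshift W h) = (\<lambda>i. case i of 0 \<Rightarrow> 0 | Suc j \<Rightarrow> W (Suc j) (ell2_nth h j))"
    unfolding wshift_def by (simp add: Abs_ell2_inverse)
  then show "ell2_nth (wshift W h) 0 = 0" "ell2_nth (wshift W h) (Suc i) = W (Suc i) (ell2_nth h i)"
    by simp_all
qed

lemma ell2_nth_wshift_adj: "ell2_nth (wshift_adj W h) i = W (Suc i) (ell2_nth h (Suc i))"
proof -
  have "summable (\<lambda>i. (norm (ell2_nth h (Suc i)))\<^sup>2)"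
    using summable_ell2[of h] by (subst summable_Suc_iff)
  then have "summable (\<lambda>i. (norm (W (Suc i) (ell2_nth h (Suc i))))\<^sup>2)"
    by (rule summable_comparison_test'[OF summable_mult[where c = "M\<^sup>2"]]) (simp add: norm_sq_weight_le)
  then show ?thesis
    unfolding wshift_adj_def by (simp add: Abs_ell2_inverse)
qed

lemma norm_wshift_le: "norm (wshift W h) \<le> M * norm h"
proof (rule power2_le_imp_le)
  have "(norm (wshift W h))\<^sup>2 = (\<Sum>i. (norm (ell2_nth (wshift W h) (Suc i)))\<^sup>2)"
    using suminf_split_head[OF summable_ell2[of "wshift W h"]]
    by (simp add: power2_norm_ell2 ell2_nth_wshift)
  also have "\<dots> \<le> (\<Sum>i. M\<^sup>2 * (norm (ell2_nth h i))\<^sup>2)"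
    unfolding ell2_nth_wshift
    by (intro suminf_le norm_sq_weight_le summable_shift summable_mult summable_ell2)
  also have "\<dots> = (M * norm h)\<^sup>2"
    by (simp add: suminf_mult summable_ell2 power_mult_distrib power2_norm_ell2)
  finally show "(norm (wshift W h))\<^sup>2 \<le> (M * norm h)\<^sup>2" .
qed (simp add: M)

lemma bounded_clinear_wshift: "bounded_clinear (wshift W)"
proof -
  have W: "linear (W (Suc i))" "W (Suc i) (a *\<^sub>C x) = a *\<^sub>C W (Suc i) x" for i a x
    using bounded[of i] by (simp_all add: bounded_clinear_def bounded_linear.linear)
  have "bounded_linear (wshift W)"
  proof (rule bounded_linear_intro[where K = M])
    show "wshift W (x + y) = wshift W x + wshift W y" for x y
    proof (rule ell2_eqI)
      show "ell2_nth (wshift W (x + y)) i = ell2_nth (wshift W x + wshift W y) i" for i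
        by (cases i) (simp_all add: ell2_nth_wshift plus_ell2.rep_eq linear_add[OF W(1)])
    qed
    show "wshift W (r *\<^sub>R x) = r *\<^sub>R wshift W x" for r x
    proof (rule ell2_eqI)
      show "ell2_nth (wshift W (r *\<^sub>R x)) i = ell2_nth (r *\<^sub>R wshift W x) i" for i
        by (cases i) (simp_all add: ell2_nth_wshift scaleR_ell2.rep_eq linear_scale[OF W(1)])
    qed
    show "norm (wshift W x) \<le> norm x * M" for x
      using norm_wshift_le by (simp add: mult.commute)
  qed
  moreover have "wshift W (a *\<^sub>C x) = a *\<^sub>C wshift W x" for a x
  proof (rule ell2_eqI)
    have [simp]: "a *\<^sub>C (0::'a) = 0"
      using norm_scaleC[of a "0::'a"] by simp
    show "ell2_nth (wshift W (a *\<^sub>C x)) i = ell2_nth (a *\<^sub>C wshift W x) i" for i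
      by (cases i) (simp_all add: ell2_nth_wshift scaleC_ell2.rep_eq W(2))
  qed
  ultimately show ?thesis by (simp add: bounded_clinear_def)
qed

lemma unilateral_weighted_shift_wshift: "unilateral_weighted_shift W (wshift W)"
  unfolding unilateral_weighted_shift_def
proof (intro conjI allI impI exI[of _ M])
  fix i :: nat assume "i \<ge> 1"
  then obtain j where i: "i = Suc j" by (cases i) auto
  show "bounded_clinear (W i)" using bounded i by simp
  show "onorm (W i) \<le> M" unfolding i by (intro onorm_bound M)
qed (simp_all add: ell2_nth_wshift bounded_clinear_wshift)

text \<open>Entry 0 of a shifted sequence vanishes, so the inner product can be reindexed by
  \<open>Suc\<close>; the weights then move across termwise.\<close>

lemma cadjoint_wshift: "cadjoint (wshift W) = wshift_adj W"
proof (rule cadjoint_eqI)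
  fix x y
  have "cinner (wshift W x) y = (\<Sum>i. cinner (ell2_nth (wshift W x) (Suc i)) (ell2_nth y (Suc i)))"
    using suminf_split_head[OF ell2_cinner_summable[OF summable_ell2 summable_ell2], of "wshift W x" y]
    by (simp add: cinner_ell2.rep_eq ell2_nth_wshift)
  also have "\<dots> = cinner x (wshift_adj W y)"
    using sa by (simp add: cinner_ell2.rep_eq ell2_nth_wshift ell2_nth_wshift_adj selfadj_def)
  finally show "cinner (wshift W x) y = cinner x (wshift_adj W y)" .
qed

text \<open>The shift is tested on sequences supported at the single position \<open>n\<close>. This
  gives the lower estimate of its norm.\<close>

lemma norm_weight_le_onorm: "norm (W (Suc n) x) \<le> onorm (wshift W) * norm x"
proof -
  have "norm (W (Suc n) x) \<le> norm (wshift W (single_ell2 n x))"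
    using norm_ell2_nth_le[of "wshift W (single_ell2 n x)" "Suc n"]
    by (simp add: ell2_nth_wshift ell2_nth_single)
  also have "\<dots> \<le> onorm (wshift W) * norm (single_ell2 n x)"
    using bounded_clinear_wshift by (intro onorm) (simp add: bounded_clinear_def)
  finally show ?thesis by (simp add: norm_single_ell2)
qed

text \<open>Through the factorisation \<open>P\<^sub>i g = h\<^sub>i\<close> the weights between positions \<open>i\<close> and \<open>i + k\<close>
  telescope, so that the forward and backward shifts only see \<open>P\<^sub>i\<close> and its adjoint \<open>R\<^sub>i\<close>.\<close>

lemma wshift_power_nth:
  assumes "\<And>i. P (Suc i) = W (Suc i) \<circ> P i" "ell2_nth h i = P i g"
  shows "ell2_nth ((wshift W ^^ k) h) (i + k) = P (i + k) g"
proof (induction k)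
  case 0
  show ?case using assms(2) by simp
next
  case (Suc k)
  have "ell2_nth ((wshift W ^^ Suc k) h) (i + Suc k) = W (Suc (i + k)) (P (i + k) g)"
    using Suc by (simp add: ell2_nth_wshift)
  then show ?case by (simp only: assms(1) add_Suc_right comp_apply)
qed

lemma wshift_adj_power_nth:
  assumes "\<And>i. R (Suc i) = R i \<circ> W (Suc i)"
  shows "R i (ell2_nth ((wshift_adj W ^^ k) h) i) = R (i + k) (ell2_nth h (i + k))"
\<comment> \<open>The innermost backward shift is peeled off, so the hypothesis is applied to
  \<open>wshift_adj W h\<close>.\<close>
proof (induction k arbitrary: h)
  case 0
  show ?case by simp
next
  case (Suc k)
  have "R i (ell2_nth ((wshift_adj W ^^ Suc k) h) i) = R (i + k) (ell2_nth (wshift_adj W h) (i + k))"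
    by (simp only: funpow_Suc_right comp_apply Suc)
  also have "\<dots> = R (i + Suc k) (ell2_nth h (i + Suc k))"
    by (simp only: assms ell2_nth_wshift_adj add_Suc_right comp_apply)
  finally show ?case .
qed

end

section \<open>Construction of the weights\<close>

text \<open>The inverses \<open>R'\<close> and \<open>P'\<close> are again adjoint to each other, so
  the form of \<open>B = R' \<circ> A \<circ> P'\<close> at \<open>f\<close> is that of
  \<open>A\<close> at \<open>P' f\<close>. Hence \<open>B\<close> is positive, and its root is the
  weight.\<close>

lemma next_weight:
  fixes P R A :: "'a::chilbert_space \<Rightarrow> 'a"
  assumes P: "invertible_op P" and R: "invertible_op R"
    and adj: "\<And>x y. cinner (P x) y = cinner x (R y)"
    and A: "positive_op A" "invertible_op A"
  obtains W where "positive_op W" "invertible_op W" "(R \<circ> W) \<circ> (W \<circ> P) = A"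
proof -
  obtain P' where P': "bounded_clinear P" "bounded_clinear P'" "P \<circ> P' = id" "P' \<circ> P = id"
    using P unfolding invertible_op_def by blast
  obtain R' where R': "bounded_clinear R" "bounded_clinear R'" "R \<circ> R' = id" "R' \<circ> R = id"
    using R unfolding invertible_op_def by blast
  have P_P': "P (P' x) = x" "P' (P x) = x" and R_R': "R (R' x) = x" "R' (R x) = x" for x
    using P' R' by (simp_all add: fun_eq_iff)
  have adj': "cinner (R' x) y = cinner x (P' y)" for x y
    using adj[of "P' y" "R' x"] by (metis P_P'(1) R_R'(1) cinner_commute)
  define B where "B = R' \<circ> A \<circ> P'"
  have invB: "invertible_op B"
    unfolding B_def using P' R' A
    by (intro invertible_op_compose invertible_op_inverse[of R' R] invertible_op_inverse[of P' P])
  have "positive_op B"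
    unfolding positive_op_def
  proof (intro conjI allI impI)
    show "bounded_clinear B" using invB by (simp add: invertible_op_def)
    fix f :: 'a assume "f \<noteq> 0"
    have "P 0 = 0" using P'(1) by (simp add: bounded_clinear_def linear_0 bounded_linear.linear)
    with \<open>f \<noteq> 0\<close> have "P' f \<noteq> 0" by (metis P_P'(1))
    then show "cinner (B f) f \<in> \<real>" "0 < Re (cinner (B f) f)"
      using A(1) by (simp_all add: B_def adj' positive_op_def)
  qed
  then obtain W where W: "positive_op W" "invertible_op W" "W \<circ> W = B"
    using positive_invertible_sqrt invB by blast
  have "W (W x) = R' (A (P' x))" for x
    using W(3) by (simp add: B_def fun_eq_iff)
  then have "(R \<circ> W) \<circ> (W \<circ> P) = A"
    by (simp add: fun_eq_iff R_R' P_P')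
  with W show thesis using that by blast
qed

text \<open>Dependent choice runs over pairs of a partial product and its adjoint, which are all
  that \<open>next_weight\<close> needs. The weights live in the transitions and are extracted
  afterwards.\<close>

lemma weight_factorisation:
  fixes A :: "nat \<Rightarrow> 'a::chilbert_space \<Rightarrow> 'a"
  assumes A0: "A 0 = id" and A: "\<And>n. positive_op (A n)" "\<And>n. invertible_op (A n)"
  obtains W R where "\<And>n. positive_op (W (Suc n))" "\<And>n. invertible_op (W (Suc n))"
    "\<And>n. invertible_op (weight_prod W n)" "\<And>n. invertible_op (R n)"
    "\<And>n x y. cinner (weight_prod W n x) y = cinner x (R n y)"
    "\<And>n. R n \<circ> weight_prod W n = A n" "\<And>n. R (Suc n) = R n \<circ> W (Suc n)"
proof -
  define good where "good n t \<longleftrightarrow> (case t of (P, R) \<Rightarrow> invertible_op P \<and> invertible_op R \<and>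
      (\<forall>x y. cinner (P x) y = cinner x (R y)) \<and> R \<circ> P = A n)" for n t
  define step where "step t t' W \<longleftrightarrow> positive_op W \<and> invertible_op W \<and>
      fst t' = W \<circ> fst t \<and> snd t' = snd t \<circ> W" for t t' :: "('a \<Rightarrow> 'a) \<times> ('a \<Rightarrow> 'a)" and W
  have "invertible_op (id :: 'a \<Rightarrow> 'a)"
    using A0 A(2)[of 0] by simp
  then have "good 0 (id, id)" by (simp add: good_def A0)
  moreover have "\<exists>t'. good (Suc n) t' \<and> (\<exists>W. step t t' W)" if "good n t" for n t
  proof -
    obtain P R where t: "t = (P, R)" by (cases t)
    have PR: "invertible_op P" "invertible_op R" "\<And>x y. cinner (P x) y = cinner x (R y)"
      using that by (simp_all add: good_def t)
    obtain W where W: "positive_op W" "invertible_op W" "(R \<circ> W) \<circ> (W \<circ> P) = A (Suc n)"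
      using next_weight[OF PR A(1) A(2)] by blast
    have "cinner ((W \<circ> P) x) y = cinner x ((R \<circ> W) y)" for x y
      using positive_op_selfadj[OF W(1)] PR(3) by (simp add: selfadj_def)
    then have "good (Suc n) (W \<circ> P, R \<circ> W)"
      using W PR by (simp add: good_def invertible_op_compose)
    then show ?thesis using W by (auto simp: step_def t)
  qed
  \<comment> \<open>The clause for \<open>n = 0\<close> pins the start to \<open>(id, id)\<close>,
    since the choice principle only guarantees the chosen predicate there.\<close>
  ultimately obtain f where "\<forall>n. (good n (f n) \<and> (n = 0 \<longrightarrow> f n = (id, id))) \<and> (\<exists>W. step (f n) (f (Suc n)) W)"
    using dependent_nat_choice[of "\<lambda>n t. good n t \<and> (n = 0 \<longrightarrow> t = (id, id))" "\<lambda>_ t t'. \<exists>W. step t t' W"]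
    by auto
  then have f: "\<And>n. good n (f n)" "\<And>n. \<exists>W. step (f n) (f (Suc n)) W" "f 0 = (id, id)"
    by auto
  obtain V where V: "\<And>n. step (f n) (f (Suc n)) (V n)"
    using f(2) by metis
  define W where "W n = V (n - 1)" for n
  have W: "step (f n) (f (Suc n)) (W (Suc n))" for n
    using V by (simp add: W_def)
  have prod: "weight_prod W n = fst (f n)" for n
    by (induction n) (use W f(3) in \<open>auto simp: step_def\<close>)
  show thesis
  proof (rule that[of W "\<lambda>n. snd (f n)"])
    show "positive_op (W (Suc n))" "invertible_op (W (Suc n))" "snd (f (Suc n)) = snd (f n) \<circ> W (Suc n)" for n
      using W[of n] by (simp_all add: step_def)
    show "invertible_op (weight_prod W n)" "invertible_op (snd (f n))"
      "cinner (weight_prod W n x) y = cinner x (snd (f n) y)" "snd (f n) \<circ> weight_prod W n = A n" for n x y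
      using f(1)[of n] by (auto simp: good_def prod split: prod.splits)
  qed
qed

theorem theorem3p4:
  fixes p :: "complex \<Rightarrow> 'a::chilbert_space \<Rightarrow> 'a" and m :: nat
  assumes "m \<ge> 1"
    and "p \<in> op_polys (m - 1)"
    and "p 0 = id"
    and "\<And>n :: nat. positive_op (p (of_nat n)) \<and> invertible_op (p (of_nat n))"
    and "growth_const p < \<infinity>"
  shows "\<exists>(S :: 'a ell2 \<Rightarrow> 'a ell2) (W :: nat \<Rightarrow> 'a \<Rightarrow> 'a).
      unilateral_weighted_shift W S \<and>
      (\<forall>j\<ge>1. positive_op (W j) \<and> invertible_op (W j)) \<and>
      m_isometric m S \<and>
      (\<forall>n\<ge>1. p (of_nat n) = abs_op (weight_prod W n) ^^ 2) \<and>
      onorm S = sqrt (enn2real (growth_const p))"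
proof -
  obtain W R where W: "\<And>n. positive_op (W (Suc n))" "\<And>n. invertible_op (W (Suc n))"
    and P: "\<And>n. invertible_op (weight_prod W n)"
    and R: "\<And>n. invertible_op (R n)"
    and adj: "\<And>n x y. cinner (weight_prod W n x) y = cinner x (R n y)"
    and RP: "\<And>n. R n \<circ> weight_prod W n = p (of_nat n)"
    and R_Suc: "\<And>n. R (Suc n) = R n \<circ> W (Suc n)"
  proof (rule weight_factorisation[of "\<lambda>n. p (of_nat n)"])
    show "p (of_nat 0) = id" using assms(3) by simp
  qed (use assms(4) in auto)
  have form: "cinner (p (of_nat n) h) h = of_real ((norm (weight_prod W n h))\<^sup>2)" for n h
  proof -
    have "cinner h (R n (weight_prod W n h)) = of_real ((norm (weight_prod W n h))\<^sup>2)"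
      unfolding adj[symmetric] by (rule cinner_norm)
    then show ?thesis
      by (subst cinner_commute) (simp add: RP[symmetric])
  qed
  have nz: "weight_prod W n h \<noteq> 0" if "h \<noteq> 0" for n h
    using assms(4)[of n] that form[of n h] by (auto simp: positive_op_def)
  have ratio: "Re (cinner (p (of_nat (n + 1)) h) h / cinner (p (of_nat n) h) h)
      = (norm (W (Suc n) (weight_prod W n h)))\<^sup>2 / (norm (weight_prod W n h))\<^sup>2" for n h
    using form[of n h] form[of "n + 1" h] by (simp flip: of_real_divide of_real_power)
  define C where "C = enn2real (growth_const p)"
  have C: "growth_const p = ennreal C" "C \<ge> 0"
    using assms(5) by (simp_all add: C_def less_top)
  have surj: "\<exists>h. weight_prod W n h = x" for n x
    using P[of n] unfolding invertible_op_def by (metis comp_apply id_apply)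
  \<comment> \<open>Every \<open>x\<close> is a value of the partial product, so the quotients in
    the supremum control each weight on the whole space.\<close>
  interpret bounded_selfadj_weights W "sqrt C"
  proof
    show "bounded_clinear (W (Suc i))" "selfadj (W (Suc i))" for i
      using W(1)[of i] by (simp_all add: positive_op_selfadj) (simp add: positive_op_def)
    show "sqrt C \<ge> 0" using C by simp
    fix i and x :: 'a
    obtain h where h: "weight_prod W i h = x" using surj by blast
    show "norm (W (Suc i) x) \<le> sqrt C * norm x"
    \<comment> \<open>The supremum omits \<open>h = 0\<close>; there \<open>form\<close> makes both
      sides vanish.\<close>
    proof (cases "h = 0")
      case True
      have "norm (weight_prod W i 0) = 0"
        using form[of i 0] by (simp del: of_real_power)
      moreover have "norm (weight_prod W (Suc i) 0) = 0"
        using form[of "Suc i" 0] by (simp del: of_real_power)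
      ultimately show ?thesis using True h by simp
    next
      case False
      have "ennreal ((norm (W (Suc i) x))\<^sup>2 / (norm x)\<^sup>2) \<le> ennreal C"
        unfolding C(1)[symmetric] growth_const_def
        by (rule Sup_upper) (unfold mem_Collect_eq h[symmetric] ratio[symmetric], use False in blast)
      then have "(norm (W (Suc i) x))\<^sup>2 / (norm x)\<^sup>2 \<le> C"
        using C(2) by simp
      moreover have "0 < (norm x)\<^sup>2"
        using nz[OF False, of i] h by simp
      ultimately have "(norm (W (Suc i) x))\<^sup>2 \<le> C * (norm x)\<^sup>2"
        by (simp only: pos_divide_le_eq)
      then show ?thesis
        by - (rule power2_le_imp_le, simp_all add: power_mult_distrib C(2))
    qed
  qed
  have "onorm (wshift W) = sqrt C"
  proof (rule antisym)
    show "onorm (wshift W) \<le> sqrt C"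
      by (intro onorm_bound norm_wshift_le M)
    have pos: "onorm (wshift W) \<ge> 0"
      using bounded_clinear_wshift by (intro onorm_pos_le) (simp add: bounded_clinear_def)
    \<comment> \<open>On the zero space the supremum is over the empty set, hence 0 in
      \<open>ennreal\<close>, and the same argument applies.\<close>
    have "growth_const p \<le> ennreal ((onorm (wshift W))\<^sup>2)"
      unfolding growth_const_def
    proof (rule Sup_least, clarify)
      fix n and h :: 'a assume "h \<noteq> 0"
      have "(norm (W (Suc n) (weight_prod W n h)))\<^sup>2 \<le> (onorm (wshift W) * norm (weight_prod W n h))\<^sup>2"
        by (intro power_mono norm_weight_le_onorm) simp
      then show "ennreal (Re (cinner (p (of_nat (n + 1)) h) h / cinner (p (of_nat n) h) h))
          \<le> ennreal ((onorm (wshift W))\<^sup>2)"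
        unfolding ratio using nz[OF \<open>h \<noteq> 0\<close>, of n]
        by (intro ennreal_leI) (simp add: field_simps power_mult_distrib)
    qed
    then have "C \<le> (onorm (wshift W))\<^sup>2" by (simp add: C)
    then show "sqrt C \<le> onorm (wshift W)"
      using pos by (intro real_le_lsqrt) auto
  qed
  moreover have "p (of_nat n) = abs_op (weight_prod W n) ^^ 2" for n
  proof -
    have *: "cadjoint (weight_prod W n) \<circ> weight_prod W n = p (of_nat n)"
      by (simp add: cadjoint_eqI[OF adj] RP)
    obtain B where B: "positive_op B" "B \<circ> B = p (of_nat n)"
      using positive_invertible_sqrt[of "p (of_nat n)"] assms(4) by blast
    \<comment> \<open>The existence of one root makes the choice in \<open>sqrt_op\<close>
      meaningful; whichever root it picks, its square is \<open>p (of_nat n)\<close>.\<close>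
    have "nonneg_op (sqrt_op (p (of_nat n))) \<and> sqrt_op (p (of_nat n)) \<circ> sqrt_op (p (of_nat n)) = p (of_nat n)"
      unfolding sqrt_op_def by (rule someI[of _ B]) (simp add: B positive_op_nonneg_op)
    then show ?thesis
      by (simp add: abs_op_def * numeral_2_eq_2)
  qed
  moreover have "m_isometric m (wshift W)"
    unfolding m_isometric_def
  proof (intro conjI allI bounded_clinear_wshift ell2_eqI)
    fix h :: "'a ell2" and i
    obtain g where g: "ell2_nth h i = weight_prod W i g" using surj by metis
    let ?x = "\<lambda>k. ell2_nth ((wshift_adj W ^^ k) ((wshift W ^^ k) h)) i"
    have x: "R i (?x k) = p (of_nat (i + k)) g" for k
      using wshift_adj_power_nth[where R = R, OF R_Suc] wshift_power_nth[where P = "weight_prod W", OF _ g]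
        RP[of "i + k"] by (simp add: fun_eq_iff)
    \<comment> \<open>Injectivity of \<open>R i\<close> allows the identity at entry
      \<open>i\<close> to be checked after applying \<open>R i\<close>, where it becomes a finite
      difference of \<open>p\<close>.\<close>
    have inj: "y = z" if "R i y = R i z" for y z
      using R[of i] that unfolding invertible_op_def by (metis comp_apply id_apply)
    have lin: "linear (R i)"
      using R[of i] by (simp add: invertible_op_def bounded_clinear_def bounded_linear.linear)
    have "R i (\<Sum>k=0..m. (real (m choose k) * (-1) ^ (m - k)) *\<^sub>R ?x k)
        = (\<Sum>k=0..m. (real (m choose k) * (-1) ^ (m - k)) *\<^sub>R p (of_nat (i + k)) g)"
      by (simp only: linear_sum[OF lin] linear_scale[OF lin] x)
    also have "\<dots> = R i 0"
      using op_polys_difference_eq_0[OF assms(2,1)] linear_0[OF lin] by simp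
    finally have "(\<Sum>k=0..m. (real (m choose k) * (-1) ^ (m - k)) *\<^sub>R ?x k) = 0"
      by (rule inj)
    then show "ell2_nth (\<Sum>k=0..m. (real (m choose k) * (-1) ^ (m - k)) *\<^sub>R
        (cadjoint (wshift W) ^^ k) ((wshift W ^^ k) h)) i = ell2_nth 0 i"
      by (simp add: ell2_nth_sum scaleR_ell2.rep_eq zero_ell2.rep_eq cadjoint_wshift)
  qed
  moreover have "positive_op (W j) \<and> invertible_op (W j)" if "j \<ge> 1" for j
    using W[of "j - 1"] that by simp
  ultimately show ?thesis
    using unilateral_weighted_shift_wshift unfolding C_def by blast
qed

end
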